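(* Let $L>4$ be an integer, $\tau>0$, $\gamma>0$, and let $K\in\mathbb C^{M\times M}$ be self-adjoint ($K=K^*$). Let $\widehat A$ and $P(-1)$ be, respectively, the rescaled implicit-Euler tracking-type all-at-once matrix and its ParaDiag preconditioner with $\alpha=-1$, as defined in the context. If $0<\varphi<1$ for every $\varphi=(1+\tau\sigma)^{-1}$ with $\sigma$ an eigenvalue of $K$ (which occurs whenever $K$ is positive definite), then all eigenvalues of the preconditioned matrix $P(-1)^{-1}\widehat A$ lie within $$\mathcal D_{0.5,+}=\{z\in\mathbb C:\ |z-0.5|\le 0.5,\ \operatorname{Re}(z)\ge0.5\}.$$
   Context: Let $\widehat L=L-1$, let $I_t$ be the $\widehat L\times\widehat L$ identity, $I_x$ the $M\times M$ identity, and $\otimes$ the Kronecker product. Let $B\in\mathbb R^{\widehat L\times\widehat L}$ have $1$ on the diagonal, $-1$ on the first subdiagonal and zeros elsewhere. Let $C(\alpha)$ be equal to $B$ except that its top-right entry (row $1$, column $\widehat L$) is $-\alpha$. Define $$\widehat A=\begin{bmatrix}B&\frac{\tau}{\sqrt\gamma}I_t\\-\frac{\tau}{\sqrt\gamma}I_t&B^\top\end{bmatrix}\otimes I_x+\tau\begin{bmatrix}I_t&0\\0&I_t\end{bmatrix}\otimes K,\qquad P(\alpha)=\begin{bmatrix}C(\alpha)&\frac{\tau}{\sqrt\gamma}I_t\\-\frac{\tau}{\sqrt\gamma}I_t&C(\alpha)^*\end{bmatrix}\otimes I_x+\tau\begin{bmatrix}I_t&0\\0&I_t\end{bmatrix}\otimes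 K.$$ $\mathcal D_{0.5,+}$ is the right half of the disk in the complex plane centered at $0.5$ with radius $0.5$. *)

theory Defs
  imports "Jordan_Normal_Form.Schur_Decomposition"
begin

definition kronecker_product :: "'a::times mat \<Rightarrow> 'a mat \<Rightarrow> 'a mat"  (infixl \<open>\<otimes>\<^sub>K\<close> 70)
  where "X \<otimes>\<^sub>K Y = mat (dim_row X * dim_row Y) (dim_col X * dim_col Y)
    (\<lambda>(i, j). X $$ (i div dim_row Y, j div dim_col Y) * Y $$ (i mod dim_row Y, j mod dim_col Y))"

definition euler_mat :: "nat \<Rightarrow> complex mat"
  where "euler_mat n = mat n n (\<lambda>(i, j). if i = j then 1 else if i = Suc j then - 1 else 0)"

(* Indices start at 0, so the top-right entry is (0, n - 1). *)
definition alpha_circulant :: "nat \<Rightarrow> complex \<Rightarrow> complex mat"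
  where "alpha_circulant n \<alpha> =
    mat n n (\<lambda>(i, j). if i = 0 \<and> j = n - 1 then - \<alpha> else euler_mat n $$ (i, j))"

(* With D = euler_mat (L - 1), E = its transpose this is the all-at-once matrix; with
   D = alpha_circulant (L - 1) \<alpha>, E = its conjugate transpose it is the ParaDiag preconditioner. *)
definition tracking_mat ::
  "nat \<Rightarrow> complex mat \<Rightarrow> complex mat \<Rightarrow> real \<Rightarrow> real \<Rightarrow> complex mat \<Rightarrow> complex mat"
  where "tracking_mat n D E \<tau> \<gamma> K =
    (let c = complex_of_real (\<tau> / sqrt \<gamma>) in
      four_block_mat D (c \<cdot>\<^sub>m 1\<^sub>m n) ((- c) \<cdot>\<^sub>m 1\<^sub>m n) E \<otimes>\<^sub>K 1\<^sub>m (dim_row K)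
      + complex_of_real \<tau> \<cdot>\<^sub>m
        (four_block_mat (1\<^sub>m n) (0\<^sub>m n n) (0\<^sub>m n n) (1\<^sub>m n) \<otimes>\<^sub>K K))"

definition all_at_once :: "nat \<Rightarrow> real \<Rightarrow> real \<Rightarrow> complex mat \<Rightarrow> complex mat"
  where "all_at_once L \<tau> \<gamma> K =
    tracking_mat (L - 1) (euler_mat (L - 1)) (transpose_mat (euler_mat (L - 1))) \<tau> \<gamma> K"

definition paradiag_precond :: "nat \<Rightarrow> real \<Rightarrow> real \<Rightarrow> complex mat \<Rightarrow> complex \<Rightarrow> complex mat"
  where "paradiag_precond L \<tau> \<gamma> K \<alpha> =
    tracking_mat (L - 1) (alpha_circulant (L - 1) \<alpha>) (mat_adjoint (alpha_circulant (L - 1) \<alpha>))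
      \<tau> \<gamma> K"

(* The order on complex is the one of HOL-Library.Complex_Order: 0 < z means that z is real
   and positive. *)
definition positive_definite :: "complex mat \<Rightarrow> bool"
  where "positive_definite K \<longleftrightarrow> square_mat K \<and> mat_adjoint K = K \<and>
    (\<forall>v \<in> carrier_vec (dim_row K). v \<noteq> 0\<^sub>v (dim_row K) \<longrightarrow> 0 < (K *\<^sub>v v) \<bullet>c v)"

(* As above, 0 < \<phi> < 1 includes that \<phi> is real. *)
definition resolvent_condition :: "real \<Rightarrow> complex mat \<Rightarrow> bool"
  where "resolvent_condition \<tau> K \<longleftrightarrow>
    (\<forall>\<sigma> \<phi>. eigenvalue K \<sigma> \<and> \<phi> = inverse (1 + complex_of_real \<tau> * \<sigma>) \<longrightarrow> 0 < \<phi> \<and> \<phi> < 1)"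

definition right_half_disk :: "complex set"
  where "right_half_disk = {z. cmod (z - 1 / 2) \<le> 1 / 2 \<and> Re z \<ge> 1 / 2}"

end

theory Submission
  imports Defs
begin

text \<open>
  Write \<open>A\<close> for the all-at-once matrix and \<open>P = P(-1)\<close>. The two differ by \<open>P = A + R \<otimes> I\<close>, where
  \<open>R\<close> has just two nonzero entries, at the two corners that \<open>C(-1)\<close> and its adjoint add to \<open>B\<close>
  and \<open>B\<^sup>T\<close>. So \<open>A v = z P v\<close> says \<open>A v = \<mu> (R \<otimes> I) v\<close> with \<open>\<mu> = z / (1 - z)\<close> (for \<open>z \<noteq> 1\<close>, and \<open>1\<close>
  lies in the half disk), while \<open>P v = 0\<close> is the case \<open>\<mu> = -1\<close> of the same equation. The map
  \<open>z \<mapsto> z / (1 - z)\<close> carries the disk without \<open>1\<close> to the half plane \<open>Re \<mu> \<ge> 0\<close> and the half plane \<open>Re z \<ge> 1/2\<close> to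
  \<open>|\<mu>| \<ge> 1\<close>. Everything therefore follows once \<open>Re \<mu> > 0\<close> and \<open>|\<mu>| > 1\<close> are known for every
  \<open>\<mu>\<close> with \<open>A v = \<mu> (R \<otimes> I) v\<close>, \<open>v \<noteq> 0\<close>; the first of them excludes \<open>\<mu> = -1\<close>, so \<open>P\<close> is
  invertible.

  Reading \<open>v\<close> as a matrix \<open>V\<close>, the Kronecker pencil becomes a Sylvester equation
  \<open>G V + b V K\<^sup>T = 0\<close>. After a Schur triangularization of \<open>K\<^sup>T\<close> the first nonzero column of \<open>V\<close>
  solves the same equation with \<open>K\<close> replaced by one of its eigenvalues \<open>\<sigma>\<close>
  (lemma \<open>matrix_equation_reduction\<close>). Put \<open>t = 1 + \<tau> \<sigma> = 1 / \<phi>\<close>, which is real and exceeds \<open>1\<close>, and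
  \<open>c = \<tau> / sqrt \<gamma>\<close>. The remaining system is a two-term recurrence for the state \<open>u\<close> and the
  adjoint \<open>w\<close>,
  \<open>u\<^sub>j = t u\<^sub>j\<^sub>+\<^sub>1 + c w\<^sub>j\<^sub>+\<^sub>1\<close> and \<open>w\<^sub>j\<^sub>+\<^sub>1 = t w\<^sub>j - c u\<^sub>j\<close> for \<open>0 \<le> j < k\<close>,
  closed by \<open>t u\<^sub>0 + c w\<^sub>0 = \<mu> u\<^sub>k\<close> and \<open>t w\<^sub>k - c u\<^sub>k = \<mu> w\<^sub>0\<close>.

  Solving the recurrence for the values \<open>u\<^sub>0\<close>, \<open>w\<^sub>k\<close> in terms of \<open>u\<^sub>k\<close>, \<open>w\<^sub>0\<close> gives a scaled rotation,
  \<open>u\<^sub>0 = p u\<^sub>k + q w\<^sub>0\<close> and \<open>w\<^sub>k = p w\<^sub>0 - q u\<^sub>k\<close>, with \<open>p > 0\<close>, \<open>q \<ge> 0\<close> and a quadratic relation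
  between \<open>p\<close> and \<open>q\<close> (lemma \<open>boundary_relation\<close>). Hence \<open>\<mu> = t p \<plusminus> i (t q + c)\<close>: the real part is
  positive, and the quadratic relation turns \<open>|\<mu>|\<^sup>2\<close> into
  \<open>t\<^sup>2 + c\<^sup>2 + t q (t\<^sup>2 - 1 + c\<^sup>2) / c > 1\<close> (lemma \<open>scalar_pencil_eigenvalue\<close>).
\<close>

section \<open>The scalar boundary value problem\<close>

text \<open>
  The scattering form: the recurrence runs backwards in \<open>u\<close> and forwards in \<open>w\<close>, so the natural data
  are \<open>u k\<close> and \<open>w 0\<close>. In this form the solution operator is a scaled rotation, because
  replacing \<open>(u j, w j)\<close> by \<open>(w (k - j), - u (k - j))\<close> preserves the recurrence. The quadratic relation,
  which holds trivially for \<open>p = 1\<close>, \<open>q = 0\<close>, is carried along because it is what makes the form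
  reproduce itself when a step is added at one end only.
\<close>

lemma boundary_relation:
  fixes t c :: real and u w :: "nat \<Rightarrow> complex"
  assumes t: "t > 0" and c: "c > 0"
    and u: "\<And>j. j < k \<Longrightarrow> u j = t * u (Suc j) + c * w (Suc j)"
    and w: "\<And>j. j < k \<Longrightarrow> w (Suc j) = t * w j - c * u j"
  obtains p q :: real where "p > 0" and "q \<ge> 0"
    and "c * t * (1 - p\<^sup>2 - q\<^sup>2) + q * (t\<^sup>2 - 1 - c\<^sup>2) = 0"
    and "u 0 = p * u k + q * w 0" and "w k = p * w 0 - q * u k"
proof -
  have "\<exists>p q :: real. p > 0 \<and> q \<ge> 0 \<and> c * t * (1 - p\<^sup>2 - q\<^sup>2) + q * (t\<^sup>2 - 1 - c\<^sup>2) = 0 \<and>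
      u 0 = p * u k + q * w 0 \<and> w k = p * w 0 - q * u k"
    using u w
  proof (induction k)
    case 0
    show ?case by (rule exI[of _ 1], rule exI[of _ 0]) simp
  next
    case (Suc k)
    then obtain p q :: real where p: "p > 0" and q: "q \<ge> 0"
      and inv: "c * t * (1 - p\<^sup>2 - q\<^sup>2) + q * (t\<^sup>2 - 1 - c\<^sup>2) = 0"
      and u0: "u 0 = p * u k + q * w 0" and wk: "w k = p * w 0 - q * u k"
      by (metis less_Suc_eq)
    \<comment> \<open>Substituting \<open>u k\<close> and \<open>w k\<close> into the last step gives
      \<open>d w (Suc k) = t p w 0 - t m u (Suc k)\<close>, which dictates the new coefficients.\<close>
    define m where "m = t * q + c"
    define d where "d = 1 + c * m"
    have m: "m > 0" unfolding m_def using t q c by (simp add: add_nonneg_pos)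
    have d: "d > 0" unfolding d_def using m c by (simp add: add_pos_pos)
    define p' where "p' = t * p / d"
    define q' where "q' = t * m / d"
    have dp: "d * p' = t * p" and dq: "d * q' = t * m"
      using d by (simp_all add: p'_def q'_def)
    let ?I = "\<lambda>p q. c * t * (1 - p\<^sup>2 - q\<^sup>2) + q * (t\<^sup>2 - 1 - c\<^sup>2)"
    have "d\<^sup>2 * ?I p' q' = 0"
    proof -
      have "d\<^sup>2 * ?I p' q' = c * t * (d\<^sup>2 - (d * p')\<^sup>2 - (d * q')\<^sup>2) + d * (d * q') * (t\<^sup>2 - 1 - c\<^sup>2)"
        by (simp add: algebra_simps power2_eq_square)
      also have "\<dots> = t\<^sup>2 * ?I p q"
        unfolding dp dq unfolding d_def m_def by (simp add: algebra_simps power2_eq_square)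
      finally show ?thesis using inv by simp
    qed
    hence inv': "?I p' q' = 0" using d by simp
    have uk: "u k = t * u (Suc k) + c * w (Suc k)" and wS: "w (Suc k) = t * w k - c * u k"
      using Suc.prems by simp_all
    have *: "d * w (Suc k) = complex_of_real (t * p) * w 0 - complex_of_real (t * m) * u (Suc k)"
    proof -
      have "d * w (Suc k) - (complex_of_real (t * p) * w 0 - complex_of_real (t * m) * u (Suc k))
          = w (Suc k) - (t * (p * w 0 - q * (t * u (Suc k) + c * w (Suc k)))
              - c * (t * u (Suc k) + c * w (Suc k)))"
        by (simp add: d_def m_def algebra_simps)
      also have "\<dots> = 0" using wS unfolding wk uk by simp
      finally show ?thesis by simp
    qed
    have d0: "complex_of_real d \<noteq> 0" using d by simp
    have w': "w (Suc k) = p' * w 0 - q' * u (Suc k)"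
    proof -
      have "d * w (Suc k) = d * (p' * w 0 - q' * u (Suc k))"
        unfolding * dp[symmetric] dq[symmetric] of_real_mult by (simp add: algebra_simps)
      thus ?thesis using d0 by simp
    qed
    have u': "u 0 = p' * u (Suc k) + q' * w 0"
    proof -
      have e1: "t - c * q' = t / d"
        using d by (simp add: q'_def field_simps) (simp add: d_def algebra_simps)
      have "p * (t - c * q') = p'" unfolding e1 p'_def by simp
      \<comment> \<open>The two expressions for the new rotation coefficient agree only by the quadratic relation.\<close>
      moreover have "c * p * p' + q = q'"
      proof -
        have "d * (c * p * p' + q) = c * p * (d * p') + d * q" by (simp add: algebra_simps)
        also have "\<dots> = t * m"
          using inv unfolding dp unfolding d_def m_def by (simp add: algebra_simps power2_eq_square)
        also have "\<dots> = d * q'" by (simp add: dq)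
        finally show ?thesis using d by simp
      qed
      moreover have "u 0 = complex_of_real (p * (t - c * q')) * u (Suc k)
          + complex_of_real (c * p * p' + q) * w 0"
        unfolding u0 uk w' by (simp add: algebra_simps)
      ultimately show ?thesis by simp
    qed
    show ?case
      using p t d m inv' u' w' unfolding p'_def[symmetric]
      by (intro exI[of _ p'] exI[of _ q']) (simp add: p'_def q'_def)
  qed
  thus ?thesis using that by blast
qed

text \<open>
  By the boundary relation, \<open>\<mu>\<close> is an eigenvalue of the real matrix with rows \<open>(a, m)\<close> and \<open>(-m, a)\<close>,
  where \<open>a = t p\<close> and \<open>m = t q + c\<close>, with eigenvector \<open>(u k, w 0)\<close>; so \<open>\<mu> = a \<plusminus> i m\<close>.
\<close>

lemma scalar_pencil_eigenvalue:
  fixes t c :: real and u w :: "nat \<Rightarrow> complex" and \<mu> :: complex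
  assumes t: "t > 1" and c: "c > 0"
    and u: "\<And>j. j < k \<Longrightarrow> u j = t * u (Suc j) + c * w (Suc j)"
    and w: "\<And>j. j < k \<Longrightarrow> w (Suc j) = t * w j - c * u j"
    and bu: "t * u 0 + c * w 0 = \<mu> * u k"
    and bw: "t * w k - c * u k = \<mu> * w 0"
    and nz: "\<exists>j\<le>k. u j \<noteq> 0 \<or> w j \<noteq> 0"
  shows "Re \<mu> > 0" and "cmod \<mu> > 1"
proof -
  have t0: "t > 0" using t by simp
  obtain p q :: real where p: "p > 0" and q: "q \<ge> 0"
    and inv: "c * t * (1 - p\<^sup>2 - q\<^sup>2) + q * (t\<^sup>2 - 1 - c\<^sup>2) = 0"
    and u0: "u 0 = p * u k + q * w 0" and wk: "w k = p * w 0 - q * u k"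
    using boundary_relation[of t c k u w, OF t0 c u w] by blast
  define a where "a = t * p"
  define m where "m = t * q + c"
  have 1: "(\<mu> - a) * u k = m * w 0"
    using bu unfolding u0 by (simp add: a_def m_def algebra_simps)
  have 2: "(\<mu> - a) * w 0 = - (m * u k)"
    using bw unfolding wk by (simp add: a_def m_def algebra_simps)
  \<comment> \<open>If both vanish, so does \<open>u 0\<close>, and running the recurrence forwards from zero kills everything.\<close>
  have "u k \<noteq> 0 \<or> w 0 \<noteq> 0"
  proof (rule ccontr)
    assume "\<not> ?thesis"
    hence z: "u 0 = 0" "w 0 = 0" using u0 by simp_all
    have "j \<le> k \<Longrightarrow> u j = 0 \<and> w j = 0" for j
    proof (induction j)
      case 0
      show ?case using z by simp
    next
      case (Suc j)
      hence "w (Suc j) = 0" "u j = 0" using w[of j] by auto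
      thus ?case using u[of j] Suc.prems t by auto
    qed
    thus False using nz by blast
  qed
  moreover have "((\<mu> - a)\<^sup>2 + m\<^sup>2) * u k = 0" "((\<mu> - a)\<^sup>2 + m\<^sup>2) * w 0 = 0"
  proof -
    have "((\<mu> - a)\<^sup>2 + m\<^sup>2) * u k = (\<mu> - a) * ((\<mu> - a) * u k) + m * (m * u k)"
      "((\<mu> - a)\<^sup>2 + m\<^sup>2) * w 0 = (\<mu> - a) * ((\<mu> - a) * w 0) + m * (m * w 0)"
      by (simp_all add: algebra_simps power2_eq_square)
    moreover have "(\<mu> - a) * ((\<mu> - a) * u k) = - (m * (m * u k))"
      "(\<mu> - a) * ((\<mu> - a) * w 0) = - (m * (m * w 0))"
      unfolding 1 2 mult_minus_right mult.left_commute[of "\<mu> - a" "complex_of_real m"] by simp_all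
    ultimately show "((\<mu> - a)\<^sup>2 + m\<^sup>2) * u k = 0" "((\<mu> - a)\<^sup>2 + m\<^sup>2) * w 0 = 0"
      by simp_all
  qed
  ultimately have "(\<mu> - a)\<^sup>2 + m\<^sup>2 = 0" by auto
  hence "(\<mu> - a - \<i> * m) * (\<mu> - a + \<i> * m) = 0"
    by (simp add: algebra_simps power2_eq_square)
  hence "\<mu> - a - \<i> * m = 0 \<or> \<mu> - a + \<i> * m = 0" by (simp only: mult_eq_0_iff)
  hence re: "Re \<mu> = a" and im: "Im \<mu> = m \<or> Im \<mu> = - m" by (auto simp: complex_eq_iff)
  have im: "(Im \<mu>)\<^sup>2 = m\<^sup>2" using im by auto
  show "Re \<mu> > 0" using re p t0 by (simp add: a_def)
  \<comment> \<open>The multiple of the quadratic relation is chosen to eliminate \<open>p\<close>.\<close>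
  have "c * (a\<^sup>2 + m\<^sup>2) = c * (t\<^sup>2 + c\<^sup>2) + t * q * (t\<^sup>2 - 1 + c\<^sup>2)
      - t * (c * t * (1 - p\<^sup>2 - q\<^sup>2) + q * (t\<^sup>2 - 1 - c\<^sup>2))"
    by (simp add: a_def m_def algebra_simps power2_eq_square)
  hence "c * (a\<^sup>2 + m\<^sup>2) = c * (t\<^sup>2 + c\<^sup>2) + t * q * (t\<^sup>2 - 1 + c\<^sup>2)"
    unfolding inv by simp
  moreover have t2: "t\<^sup>2 > 1" using t by simp
  moreover have "t * q * (t\<^sup>2 - 1 + c\<^sup>2) \<ge> 0" using q t0 t2 by simp
  moreover have "c * 1 < c * (t\<^sup>2 + c\<^sup>2)"
    using c t2 by (intro mult_strict_left_mono add_pos_nonneg order.strict_trans2[OF t2]) auto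
  ultimately have "c * (a\<^sup>2 + m\<^sup>2) > c * 1" by linarith
  hence "a\<^sup>2 + m\<^sup>2 > 1" using c by simp
  hence "(cmod \<mu>)\<^sup>2 > 1" by (simp add: cmod_power2 re im)
  thus "cmod \<mu> > 1" using power_le_one[of "cmod \<mu>" 2] by force
qed

section \<open>Reducing a Kronecker pencil to an eigenvalue of the second factor\<close>

text \<open>
  With \<open>H = P T P\<inverse>\<close>, \<open>T\<close> upper triangular, the matrix \<open>W = V P\<close> satisfies \<open>G W + b W T = 0\<close>. Column \<open>j\<close> of
  \<open>W T\<close> combines the columns of \<open>W\<close> up to the \<open>j\<close>-th, so for the first nonzero column it is just
  \<open>T\<^sub>j\<^sub>j\<close> times that column.
\<close>

lemma matrix_equation_reduction:
  fixes G H V :: "complex mat" and b :: complex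
  assumes G: "G \<in> carrier_mat N N" and H: "H \<in> carrier_mat M M" and V: "V \<in> carrier_mat N M"
    and V0: "V \<noteq> 0\<^sub>m N M" and eq: "G * V + b \<cdot>\<^sub>m (V * H) = 0\<^sub>m N M"
  obtains \<sigma> y where "eigenvalue H \<sigma>" and "y \<in> carrier_vec N" and "y \<noteq> 0\<^sub>v N"
    and "G *\<^sub>v y + (b * \<sigma>) \<cdot>\<^sub>v y = 0\<^sub>v N"
proof -
  obtain es where es: "char_poly H = (\<Prod>e\<leftarrow>es. [:- e, 1:])"
    using char_poly_factorized[OF H] by blast
  obtain T P Q where TPQ: "schur_decomposition H es = (T, P, Q)"
    by (cases "schur_decomposition H es") auto
  from schur_decomposition[OF H es TPQ] have wit: "similar_mat_wit H T P Q"
    and ut: "upper_triangular T" by auto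
  note sim = similar_mat_witD2[OF H wit]
  have T: "T \<in> carrier_mat M M" and P: "P \<in> carrier_mat M M" and Q: "Q \<in> carrier_mat M M"
    and PQ: "P * Q = 1\<^sub>m M" and QP: "Q * P = 1\<^sub>m M" and HPTQ: "H = P * T * Q" using sim by auto
  define W where "W = V * P"
  have W: "W \<in> carrier_mat N M" using V P by (simp add: W_def)
  have HP: "H * P = P * T"
    unfolding HPTQ using P T Q QP by (simp add: assoc_mult_mat[of _ M M _ M _ M])
  have VHP: "(V * H) * P = W * T"
    unfolding W_def using V H P T HP
    by (simp add: assoc_mult_mat[of _ N M _ M _ M])
  have "(G * V + b \<cdot>\<^sub>m (V * H)) * P = G * W + b \<cdot>\<^sub>m (W * T)"
    unfolding W_def using G V H P T VHP
    by (simp add: add_mult_distrib_mat[of _ N M _ _ M] assoc_mult_mat[of _ N N _ M _ M]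
        mult_smult_assoc_mat[of _ N M _ M] W_def)
  hence eqW: "G * W + b \<cdot>\<^sub>m (W * T) = 0\<^sub>m N M" using eq P by simp
  have "W \<noteq> 0\<^sub>m N M"
  proof
    assume "W = 0\<^sub>m N M"
    hence "W * Q = 0\<^sub>m N M" using Q by simp
    moreover have "W * Q = V"
      unfolding W_def using V P Q PQ by (simp add: assoc_mult_mat[of _ N M _ M _ M])
    ultimately show False using V0 by simp
  qed
  hence "\<exists>j. j < M \<and> col W j \<noteq> 0\<^sub>v N"
    using W by (metis carrier_matD mat_col_eqI zero_carrier_mat col_zero)
  then obtain j where j: "j < M" "col W j \<noteq> 0\<^sub>v N"
    and first: "\<And>k. k < j \<Longrightarrow> col W k = 0\<^sub>v N"
    using exists_least_iff[of "\<lambda>j. j < M \<and> col W j \<noteq> 0\<^sub>v N"] by (metis less_trans)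
  have WT: "(W * T) $$ (i, j) = T $$ (j, j) * W $$ (i, j)" if i: "i < N" for i
  proof -
    have "(W * T) $$ (i, j) = (\<Sum>k<M. W $$ (i, k) * T $$ (k, j))"
      using W T i j by (simp add: scalar_prod_def lessThan_atLeast0)
    also have "\<dots> = (\<Sum>k\<in>{j}. W $$ (i, k) * T $$ (k, j))"
    proof (rule sum.mono_neutral_right)
      show "\<forall>k\<in>{..<M} - {j}. W $$ (i, k) * T $$ (k, j) = 0"
      proof
        fix k assume k: "k \<in> {..<M} - {j}"
        show "W $$ (i, k) * T $$ (k, j) = 0"
        proof (cases "k < j")
          case True
          hence "col W k $ i = 0" using first i by simp
          thus ?thesis using W i k by simp
        next
          case False
          thus ?thesis using upper_triangularD[OF ut, of j k] k T by simp
        qed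
      qed
    qed (use j in auto)
    finally show ?thesis by simp
  qed
  show thesis
  proof
    have "char_poly H = char_poly T"
      using wit by (intro char_poly_similar) (auto simp: similar_mat_def)
    moreover have "T $$ (j, j) \<in> set (diag_mat T)" using j T by (auto simp: diag_mat_def)
    ultimately show "eigenvalue H (T $$ (j, j))"
      unfolding eigenvalue_root_char_poly[OF H] char_poly_upper_triangular[OF T ut]
      by (simp add: poly_prod_list prod_list_zero_iff)
    show "col W j \<in> carrier_vec N" using W by auto
    show "col W j \<noteq> 0\<^sub>v N" by (rule j)
    show "G *\<^sub>v col W j + (b * T $$ (j, j)) \<cdot>\<^sub>v col W j = 0\<^sub>v N"
    proof (rule eq_vecI)
      fix i assume "i < dim_vec (0\<^sub>v N :: complex vec)"
      hence i: "i < N" by simp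
      have "(G * W + b \<cdot>\<^sub>m (W * T)) $$ (i, j) = 0" unfolding eqW using i j by simp
      thus "(G *\<^sub>v col W j + (b * T $$ (j, j)) \<cdot>\<^sub>v col W j) $ i = 0\<^sub>v N $ i"
        using i j W T G WT[OF i] by (simp add: mult.assoc)
    qed (use G W in auto)
  qed
qed

lemma sum_lessThan_mult:
  fixes g :: "nat \<Rightarrow> 'a::comm_monoid_add"
  shows "(\<Sum>j<N * M. g j) = (\<Sum>i<N. \<Sum>l<M. g (i * M + l))"
proof -
  have "(\<Sum>j\<in>{i * M..<i * M + M}. g j) = (\<Sum>l<M. g (i * M + l))" for i
    using sum.shift_bounds_nat_ivl[of g 0 "i * M" M] by (simp add: lessThan_atLeast0 add.commute)
  thus ?thesis by (simp flip: sum.nat_group)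
qed

text \<open>The inverse of the row-wise vectorization of an \<open>N \<times> M\<close> matrix.\<close>

definition unvec :: "nat \<Rightarrow> nat \<Rightarrow> 'a vec \<Rightarrow> 'a mat"
  where "unvec N M v = mat N M (\<lambda>(i, l). v $ (i * M + l))"

lemma unvec_carrier [simp]: "unvec N M v \<in> carrier_mat N M"
  by (simp add: unvec_def)

lemma block_index_less:
  fixes i l N M :: nat
  assumes "i < N" and "l < M"
  shows "i * M + l < N * M"
proof -
  have "i * M + l < Suc i * M" using assms by simp
  also have "\<dots> \<le> N * M" using assms by (intro mult_le_mono1) simp
  finally show ?thesis .
qed

lemma unvec_eq_iff:
  assumes v: "v \<in> carrier_vec (N * M)" and v': "v' \<in> carrier_vec (N * M)"
  shows "unvec N M v = unvec N M v' \<longleftrightarrow> v = v'"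
proof
  assume eq: "unvec N M v = unvec N M v'"
  show "v = v'"
  proof (rule eq_vecI)
    fix k assume "k < dim_vec v'"
    hence k: "k < N * M" using v' by simp
    hence M: "M > 0" by (cases M) auto
    have "k div M < N" "k mod M < M" using k M by (simp_all add: less_mult_imp_div_less)
    moreover have "unvec N M v $$ (k div M, k mod M) = unvec N M v' $$ (k div M, k mod M)"
      by (simp add: eq)
    ultimately show "v $ k = v' $ k" by (simp add: unvec_def)
  qed (use v v' in simp)
qed simp

text \<open>
  The row-wise form of the identity \<open>(X \<otimes> Y) vec V = vec (X V Y\<^sup>T)\<close>.
\<close>

lemma unvec_kronecker_mult:
  fixes X Y :: "'a::comm_ring_1 mat"
  assumes X: "X \<in> carrier_mat N N" and Y: "Y \<in> carrier_mat M M" and v: "v \<in> carrier_vec (N * M)"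
  shows "unvec N M ((X \<otimes>\<^sub>K Y) *\<^sub>v v) = X * (unvec N M v * transpose_mat Y)"
proof (rule eq_matI)
  fix i l assume "i < dim_row (X * (unvec N M v * transpose_mat Y))"
    and "l < dim_col (X * (unvec N M v * transpose_mat Y))"
  hence i: "i < N" and l: "l < M" using X Y by auto
  note il = block_index_less[OF i l]
  have div: "(a * M + r) div M = a" "(a * M + r) mod M = r" if "r < M" for a r
    using that by auto
  have "unvec N M ((X \<otimes>\<^sub>K Y) *\<^sub>v v) $$ (i, l) =
      (\<Sum>j<N * M. X $$ (i, j div M) * Y $$ (l, j mod M) * v $ j)"
    using i l il X Y v
    by (simp add: unvec_def kronecker_product_def scalar_prod_def lessThan_atLeast0)
  also have "\<dots> = (\<Sum>a<N. \<Sum>r<M. X $$ (i, a) * Y $$ (l, r) * v $ (a * M + r))"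
    unfolding sum_lessThan_mult by (intro sum.cong refl) (simp add: div)
  also have "\<dots> = (X * (unvec N M v * transpose_mat Y)) $$ (i, l)"
    using i l X Y
    by (simp add: unvec_def scalar_prod_def lessThan_atLeast0 sum_distrib_left mult_ac)
  finally show "unvec N M ((X \<otimes>\<^sub>K Y) *\<^sub>v v) $$ (i, l) =
    (X * (unvec N M v * transpose_mat Y)) $$ (i, l)" .
qed (use X Y in \<open>auto simp: unvec_def\<close>)

lemma smult_mult_mat_vec:
  fixes X :: "'a::comm_semiring_0 mat"
  assumes "X \<in> carrier_mat a b" and "v \<in> carrier_vec b"
  shows "(k \<cdot>\<^sub>m X) *\<^sub>v v = k \<cdot>\<^sub>v (X *\<^sub>v v)"
  using assms by (intro eq_vecI) auto

lemma kronecker_product_carrier: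
  "X \<in> carrier_mat a b \<Longrightarrow> Y \<in> carrier_mat c d \<Longrightarrow> X \<otimes>\<^sub>K Y \<in> carrier_mat (a * c) (b * d)"
  by (auto simp: kronecker_product_def)

lemma unvec_add:
  "v \<in> carrier_vec (N * M) \<Longrightarrow> w \<in> carrier_vec (N * M) \<Longrightarrow>
    unvec N M (v + w) = unvec N M v + unvec N M w"
  by (intro eq_matI) (auto simp: unvec_def block_index_less)

lemma unvec_smult:
  "v \<in> carrier_vec (N * M) \<Longrightarrow> unvec N M (a \<cdot>\<^sub>v v) = a \<cdot>\<^sub>m unvec N M v"
  by (intro eq_matI) (auto simp: unvec_def block_index_less)

lemma unvec_zero: "unvec N M (0\<^sub>v (N * M)) = 0\<^sub>m N M"
  by (intro eq_matI) (auto simp: unvec_def block_index_less)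

section \<open>The tracking-type matrices\<close>

lemma mat_adjoint_carrier: "X \<in> carrier_mat n m \<Longrightarrow> mat_adjoint X \<in> carrier_mat m n"
  by (auto simp: mat_adjoint_def mat_of_rows_def)

lemma euler_mat_carrier [simp]: "euler_mat n \<in> carrier_mat n n"
  by (simp add: euler_mat_def)

lemma alpha_circulant_carrier [simp]: "alpha_circulant n a \<in> carrier_mat n n"
  by (simp add: alpha_circulant_def)


text \<open>The part of the space-time matrix that couples the time steps and the two variables.\<close>

definition coupling_mat :: "nat \<Rightarrow> real \<Rightarrow> complex mat \<Rightarrow> complex mat \<Rightarrow> complex mat"
  where "coupling_mat n c D E =
    four_block_mat D (complex_of_real c \<cdot>\<^sub>m 1\<^sub>m n) ((- complex_of_real c) \<cdot>\<^sub>m 1\<^sub>m n) E"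

lemma coupling_mat_carrier:
  "D \<in> carrier_mat n n \<Longrightarrow> E \<in> carrier_mat n n \<Longrightarrow> coupling_mat n c D E \<in> carrier_mat (n + n) (n + n)"
  by (auto simp: coupling_mat_def)

lemma tracking_mat_eq:
  "tracking_mat n D E \<tau> \<gamma> K = coupling_mat n (\<tau> / sqrt \<gamma>) D E \<otimes>\<^sub>K 1\<^sub>m (dim_row K)
    + complex_of_real \<tau> \<cdot>\<^sub>m (1\<^sub>m (n + n) \<otimes>\<^sub>K K)"
  by (simp add: tracking_mat_def coupling_mat_def Let_def)

lemma tracking_mat_carrier:
  assumes "D \<in> carrier_mat n n" "E \<in> carrier_mat n n" "K \<in> carrier_mat M M"
  shows "tracking_mat n D E \<tau> \<gamma> K \<in> carrier_mat ((n + n) * M) ((n + n) * M)"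
  unfolding tracking_mat_eq using assms
  by (intro add_carrier_mat smult_carrier_mat kronecker_product_carrier one_carrier_mat) auto

lemma unvec_tracking_mat_mult:
  assumes D: "D \<in> carrier_mat n n" and E: "E \<in> carrier_mat n n" and K: "K \<in> carrier_mat M M"
    and v: "v \<in> carrier_vec ((n + n) * M)"
  shows "unvec (n + n) M (tracking_mat n D E \<tau> \<gamma> K *\<^sub>v v) =
    coupling_mat n (\<tau> / sqrt \<gamma>) D E * unvec (n + n) M v
    + complex_of_real \<tau> \<cdot>\<^sub>m (unvec (n + n) M v * transpose_mat K)"
proof -
  let ?G = "coupling_mat n (\<tau> / sqrt \<gamma>) D E"
  let ?m = "(n + n) * M"
  let ?V = "unvec (n + n) M v"
  have G: "?G \<in> carrier_mat (n + n) (n + n)" using D E by (rule coupling_mat_carrier)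
  have GI: "?G \<otimes>\<^sub>K 1\<^sub>m M \<in> carrier_mat ?m ?m" and IK: "1\<^sub>m (n + n) \<otimes>\<^sub>K K \<in> carrier_mat ?m ?m"
    using G K by (intro kronecker_product_carrier; simp)+
  have "tracking_mat n D E \<tau> \<gamma> K *\<^sub>v v =
      (?G \<otimes>\<^sub>K 1\<^sub>m M) *\<^sub>v v + complex_of_real \<tau> \<cdot>\<^sub>v ((1\<^sub>m (n + n) \<otimes>\<^sub>K K) *\<^sub>v v)"
    unfolding tracking_mat_eq using K GI IK v
    by (simp add: add_mult_distrib_mat_vec[of _ ?m ?m] smult_mult_mat_vec[of _ ?m ?m])
  moreover have "(?G \<otimes>\<^sub>K 1\<^sub>m M) *\<^sub>v v \<in> carrier_vec ?m" "(1\<^sub>m (n + n) \<otimes>\<^sub>K K) *\<^sub>v v \<in> carrier_vec ?m"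
    using GI IK v by auto
  ultimately have "unvec (n + n) M (tracking_mat n D E \<tau> \<gamma> K *\<^sub>v v) =
      unvec (n + n) M ((?G \<otimes>\<^sub>K 1\<^sub>m M) *\<^sub>v v)
      + complex_of_real \<tau> \<cdot>\<^sub>m unvec (n + n) M ((1\<^sub>m (n + n) \<otimes>\<^sub>K K) *\<^sub>v v)"
    by (simp add: unvec_add unvec_smult)
  also have "\<dots> = ?G * (?V * transpose_mat (1\<^sub>m M))
      + complex_of_real \<tau> \<cdot>\<^sub>m (1\<^sub>m (n + n) * (?V * transpose_mat K))"
    using G K v by (simp only: unvec_kronecker_mult one_carrier_mat)
  also have "\<dots> = ?G * ?V + complex_of_real \<tau> \<cdot>\<^sub>m (?V * transpose_mat K)"
    using K by (simp add: left_mult_one_mat[of _ "n + n" M] right_mult_one_mat[of _ "n + n" M]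
        mult_carrier_mat[of _ "n + n" M _ M])
  finally show ?thesis .
qed

text \<open>
  The difference between preconditioner and all-at-once matrix in the time variable: \<open>+1\<close> at the
  top right of the first diagonal block and at the bottom left of the second one.
\<close>

definition corner_mat :: "nat \<Rightarrow> complex mat"
  where "corner_mat n = mat (n + n) (n + n)
    (\<lambda>(i, j). if (i, j) = (0, n - 1) \<or> (i, j) = (n + n - 1, n) then 1 else 0)"

lemma corner_mat_carrier [simp]: "corner_mat n \<in> carrier_mat (n + n) (n + n)"
  by (simp add: corner_mat_def)

abbreviation euler_coupling :: "nat \<Rightarrow> real \<Rightarrow> complex mat"
  where "euler_coupling n c \<equiv> coupling_mat n c (euler_mat n) (transpose_mat (euler_mat n))"

text \<open>
  For \<open>n = 1\<close> the corner entry would overwrite the diagonal instead of adding to it.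
\<close>

lemma coupling_alpha_circulant:
  assumes n: "n > 1"
  shows "coupling_mat n c (alpha_circulant n (- 1)) (mat_adjoint (alpha_circulant n (- 1)))
    = euler_coupling n c + corner_mat n"
proof (rule eq_matI)
  fix i j assume ij: "i < dim_row (euler_coupling n c + corner_mat n)"
    "j < dim_col (euler_coupling n c + corner_mat n)"
  hence "i < n + n" "j < n + n" by (auto simp: corner_mat_def)
  thus "coupling_mat n c (alpha_circulant n (- 1)) (mat_adjoint (alpha_circulant n (- 1))) $$ (i, j)
    = (euler_coupling n c + corner_mat n) $$ (i, j)"
    using n
    by (cases "i < n"; cases "j < n")
      (auto simp: coupling_mat_def corner_mat_def alpha_circulant_def euler_mat_def mat_adjoint_def
        mat_of_rows_def)
qed (auto simp: coupling_mat_def corner_mat_def carrier_matD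
    [OF mat_adjoint_carrier[OF alpha_circulant_carrier]] carrier_matD[OF alpha_circulant_carrier])

lemma sum_lessThan_add:
  fixes f :: "nat \<Rightarrow> 'a::comm_monoid_add"
  shows "(\<Sum>k<n + m. f k) = (\<Sum>k<n. f k) + (\<Sum>k<m. f (n + k))"
  by (induction m) (simp_all add: add.assoc)

lemma corner_mat_mult_vec:
  assumes y: "y \<in> carrier_vec (n + n)" and i: "i < n + n"
  shows "(corner_mat n *\<^sub>v y) $ i =
    (if i = 0 then y $ (n - 1) else if i = n + n - 1 then y $ n else 0)"
proof -
  have "(corner_mat n *\<^sub>v y) $ i =
      (\<Sum>k<n + n. (if (i, k) = (0, n - 1) \<or> (i, k) = (n + n - 1, n) then 1 else 0) * y $ k)"
    using i y by (simp add: corner_mat_def scalar_prod_def lessThan_atLeast0)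
  also have "\<dots> = (\<Sum>k<n + n. if k = (if i = 0 then n - 1 else n)
      then (if i = 0 \<or> i = n + n - 1 then y $ k else 0) else 0)"
    using i by (intro sum.cong refl) auto
  also have "\<dots> = (if i = 0 then y $ (n - 1) else if i = n + n - 1 then y $ n else 0)"
    using i by (subst sum.delta) auto
  finally show ?thesis .
qed

lemma euler_coupling_mult_vec:
  assumes y: "y \<in> carrier_vec (n + n)" and j: "j < n"
  shows "(euler_coupling n c *\<^sub>v y) $ j =
      y $ j - (if j = 0 then 0 else y $ (j - 1)) + c * y $ (n + j)"
    and "(euler_coupling n c *\<^sub>v y) $ (n + j) =
      y $ (n + j) - (if Suc j = n then 0 else y $ (n + Suc j)) - c * y $ j"
proof -
  have "(euler_coupling n c *\<^sub>v y) $ j =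
      (\<Sum>k<n. (if j = k then 1 else if j = Suc k then - 1 else 0) * y $ k)
      + (\<Sum>k<n. (if j = k then complex_of_real c else 0) * y $ (n + k))"
    using j y by (simp add: coupling_mat_def euler_mat_def scalar_prod_def sum_lessThan_add
        if_distrib[of "(*) _"] flip: lessThan_atLeast0 cong: if_cong)
  also have "(\<Sum>k<n. (if j = k then complex_of_real c else 0) * y $ (n + k)) = c * y $ (n + j)"
    using j by (simp add: if_distrib[of "\<lambda>x. x * _"] cong: if_cong)
  also have "(\<Sum>k<n. (if j = k then 1 else if j = Suc k then - 1 else 0) * y $ k) =
      (\<Sum>k<n. (if j = k then y $ k else 0) - (if k = j - 1 then if j = 0 then 0 else y $ k else 0))"
    by (intro sum.cong refl) auto
  also have "\<dots> = y $ j - (if j = 0 then 0 else y $ (j - 1))"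
    using j by (simp add: sum_subtractf)
  finally show "(euler_coupling n c *\<^sub>v y) $ j =
      y $ j - (if j = 0 then 0 else y $ (j - 1)) + c * y $ (n + j)" .
  have "(euler_coupling n c *\<^sub>v y) $ (n + j) =
      (\<Sum>k<n. (if j = k then - complex_of_real c else 0) * y $ k)
      + (\<Sum>k<n. (if k = j then 1 else if k = Suc j then - 1 else 0) * y $ (n + k))"
    using j y by (simp add: coupling_mat_def euler_mat_def scalar_prod_def sum_lessThan_add
        if_distrib[of "(*) _"] flip: lessThan_atLeast0 cong: if_cong)
  also have "(\<Sum>k<n. (if j = k then - complex_of_real c else 0) * y $ k) = - c * y $ j"
    using j by (simp add: if_distrib[of "\<lambda>x. x * _"] cong: if_cong)
  also have "(\<Sum>k<n. (if k = j then 1 else if k = Suc j then - 1 else 0) * y $ (n + k)) =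
      (\<Sum>k<n. (if k = j then y $ (n + k) else 0) - (if k = Suc j then y $ (n + k) else 0))"
    by (intro sum.cong refl) auto
  also have "\<dots> = y $ (n + j) - (if Suc j = n then 0 else y $ (n + Suc j))"
    using j by (simp add: sum_subtractf)
  finally show "(euler_coupling n c *\<^sub>v y) $ (n + j) =
      y $ (n + j) - (if Suc j = n then 0 else y $ (n + Suc j)) - c * y $ j" by simp
qed

lemma euler_coupling_carrier: "euler_coupling n c \<in> carrier_mat (n + n) (n + n)"
  by (intro coupling_mat_carrier) simp_all

section \<open>The eigenvalues of the space operator\<close>

lemma resolvent_eigenvalue:
  assumes "resolvent_condition \<tau> K" and "eigenvalue K \<sigma>"
  obtains t :: real where "t > 1" and "complex_of_real \<tau> * \<sigma> = complex_of_real (t - 1)"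
proof -
  let ?z = "1 + complex_of_real \<tau> * \<sigma>"
  have *: "0 < inverse ?z" "inverse ?z < 1" using assms by (auto simp: resolvent_condition_def)
  define r where "r = Re (inverse ?z)"
  have r: "inverse ?z = complex_of_real r" "0 < r" "r < 1"
    using * by (auto simp: less_complex_def r_def complex_eq_iff)
  have z: "?z = complex_of_real (inverse r)"
    using r(1) by (metis inverse_inverse_eq of_real_inverse)
  show ?thesis
  proof
    show "inverse r > 1" using r by (simp add: one_less_inverse)
    show "complex_of_real \<tau> * \<sigma> = complex_of_real (inverse r - 1)"
      using z by (simp add: algebra_simps)
  qed
qed

lemma positive_definite_resolvent_condition:
  assumes \<tau>: "\<tau> > 0" and K: "K \<in> carrier_mat M M" and pd: "positive_definite K"
  shows "resolvent_condition \<tau> K"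
  unfolding resolvent_condition_def
proof (intro allI impI, elim conjE)
  fix \<sigma> \<phi> assume ev: "eigenvalue K \<sigma>" and \<phi>: "\<phi> = inverse (1 + complex_of_real \<tau> * \<sigma>)"
  from ev obtain v where v: "v \<in> carrier_vec M" "v \<noteq> 0\<^sub>v M" and Kv: "K *\<^sub>v v = \<sigma> \<cdot>\<^sub>v v"
    using K by (auto simp: eigenvalue_def eigenvector_def)
  have "0 < (K *\<^sub>v v) \<bullet>c v" using pd v K by (auto simp: positive_definite_def)
  hence "0 < \<sigma> * (v \<bullet>c v)" unfolding Kv using v by simp
  moreover have "0 < v \<bullet>c v" using v by simp
  ultimately have "0 < \<sigma>" by (auto simp: less_complex_def zero_less_mult_iff)
  then obtain s where s: "\<sigma> = complex_of_real s" "s > 0"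
    by (metis less_complex_def complex_eq_iff Re_complex_of_real Im_complex_of_real zero_complex.sel)
  have \<phi>r: "\<phi> = complex_of_real (inverse (1 + \<tau> * s))" unfolding \<phi> s by simp
  have "0 < inverse (1 + \<tau> * s)" "inverse (1 + \<tau> * s) < 1"
    using \<tau> s by (simp_all add: inverse_less_1_iff add_pos_pos)
  thus "0 < \<phi> \<and> \<phi> < 1"
    unfolding \<phi>r less_complex_def Re_complex_of_real Im_complex_of_real by simp
qed

section \<open>The kernel of the pencil\<close>

text \<open>
  The rows of this system are exactly the recurrence and the boundary conditions of the scalar
  problem, with multiplier \<open>\<mu> = - b / a\<close>. The homogeneous pair \<open>(a, b)\<close> covers the eigenvalue equation,
  where it is \<open>(1 - z, - z)\<close>, and the singularity of the preconditioner, where it is \<open>(1, 1)\<close>.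
\<close>

lemma shifted_pencil_kernel:
  fixes t c :: real and a b :: complex
  assumes n: "n > 1" and t: "t > 1" and c: "c > 0"
    and y: "y \<in> carrier_vec (n + n)" and y0: "y \<noteq> 0\<^sub>v (n + n)" and a: "a \<noteq> 0"
    and eq: "(a \<cdot>\<^sub>m euler_coupling n c + b \<cdot>\<^sub>m corner_mat n) *\<^sub>v y
      + (a * complex_of_real (t - 1)) \<cdot>\<^sub>v y = 0\<^sub>v (n + n)"
  shows "Re (- b / a) > 0" and "cmod (- b / a) > 1"
proof -
  define k where "k = n - 1"
  have nk: "n = Suc k" using n by (simp add: k_def)
  define u w where "u = (\<lambda>j. y $ j)" and "w = (\<lambda>j. y $ (n + j))"
  have row: "a * ((euler_coupling n c *\<^sub>v y) $ i + (t - 1) * y $ i) + b * (corner_mat n *\<^sub>v y) $ i = 0"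
    if i: "i < n + n" for i
  proof -
    let ?A = "euler_coupling n c"
    have A: "?A \<in> carrier_mat (n + n) (n + n)" by (rule euler_coupling_carrier)
    have "(a \<cdot>\<^sub>m ?A + b \<cdot>\<^sub>m corner_mat n) *\<^sub>v y = a \<cdot>\<^sub>v (?A *\<^sub>v y) + b \<cdot>\<^sub>v (corner_mat n *\<^sub>v y)"
      using A y by (simp add: add_mult_distrib_mat_vec[of _ "n + n" "n + n"]
          smult_mult_mat_vec[of _ "n + n" "n + n"])
    moreover have "dim_row ?A = n + n" "dim_row (corner_mat n) = n + n" "dim_vec y = n + n"
      using carrier_matD(1)[OF A] carrier_matD(1)[OF corner_mat_carrier[of n]] y by simp_all
    ultimately have "a * (?A *\<^sub>v y) $ i + b * (corner_mat n *\<^sub>v y) $ i + a * (t - 1) * y $ i = 0"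
      using arg_cong[OF eq, of "\<lambda>x. x $ i"] i by (simp del: index_mult_mat_vec)
    thus ?thesis by (simp add: algebra_simps)
  qed
  have u: "u j = t * u (Suc j) + c * w (Suc j)" if "j < k" for j
  proof -
    have j: "Suc j < n" "Suc j < n + n" "Suc j \<noteq> n + n - 1" using that by (simp_all add: nk)
    have "a * (y $ Suc j - y $ j + c * y $ (n + Suc j) + (t - 1) * y $ Suc j) = 0"
      using row[OF j(2)] j
      by (simp only: euler_coupling_mult_vec(1)[OF y j(1)] corner_mat_mult_vec[OF y j(2)]) simp
    hence "y $ Suc j - y $ j + c * y $ (n + Suc j) + (t - 1) * y $ Suc j = 0"
      using a by (metis mult_eq_0_iff)
    thus ?thesis by (simp add: u_def w_def algebra_simps)
  qed
  have w: "w (Suc j) = t * w j - c * u j" if "j < k" for j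
  proof -
    have j: "j < n" "n + j < n + n" "n + j \<noteq> n + n - 1" "n + j \<noteq> 0" "Suc j \<noteq> n"
      using that by (simp_all add: nk)
    have "a * (y $ (n + j) - y $ (n + Suc j) - c * y $ j + (t - 1) * y $ (n + j)) = 0"
      using row[OF j(2)] j
      by (simp only: euler_coupling_mult_vec(2)[OF y j(1)] corner_mat_mult_vec[OF y j(2)]) simp
    hence "y $ (n + j) - y $ (n + Suc j) - c * y $ j + (t - 1) * y $ (n + j) = 0"
      using a by (metis mult_eq_0_iff)
    thus ?thesis by (simp add: u_def w_def algebra_simps)
  qed
  have bu: "t * u 0 + c * w 0 = (- b / a) * u k"
  proof -
    have j: "0 < n" "0 < n + n" using n by simp_all
    have "a * (y $ 0 + c * y $ n + (t - 1) * y $ 0) + b * y $ k = 0"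
      using row[OF j(2)]
      by (simp only: euler_coupling_mult_vec(1)[OF y j(1)] corner_mat_mult_vec[OF y j(2)] k_def) simp
    hence "a * (t * u 0 + c * w 0) = a * ((- b / a) * u k)"
      using a by (simp add: u_def w_def algebra_simps add_eq_0_iff)
    thus ?thesis using mult_left_cancel[OF a] by blast
  qed
  have bw: "t * w k - c * u k = (- b / a) * w 0"
  proof -
    have j: "k < n" "n + k < n + n" "n + k = n + n - 1" "Suc k = n" "n + k \<noteq> 0"
      using n by (simp_all add: nk)
    have "(corner_mat n *\<^sub>v y) $ (n + k) = y $ n"
      using corner_mat_mult_vec[OF y j(2)] j(3,5) by metis
    moreover have "(euler_coupling n c *\<^sub>v y) $ (n + k) = y $ (n + k) - c * y $ k"
      using j(4) by (simp only: euler_coupling_mult_vec(2)[OF y j(1)] simp_thms if_True diff_zero)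
    ultimately have "a * (y $ (n + k) - c * y $ k + (t - 1) * y $ (n + k)) + b * y $ n = 0"
      using row[OF j(2)] by simp
    hence "a * (t * w k - c * u k) = a * ((- b / a) * w 0)"
      using a by (simp add: u_def w_def algebra_simps add_eq_0_iff)
    thus ?thesis using mult_left_cancel[OF a] by blast
  qed
  have nz: "\<exists>j\<le>k. u j \<noteq> 0 \<or> w j \<noteq> 0"
  proof (rule ccontr)
    assume z: "\<not> ?thesis"
    have "y $ i = 0" if "i < n + n" for i
    proof (cases "i < n")
      case True
      thus ?thesis using z by (auto simp: u_def nk)
    next
      case False
      hence "i - n \<le> k" "n + (i - n) = i" using that by (simp_all add: nk)
      thus ?thesis using z unfolding w_def by metis
    qed
    hence "y = 0\<^sub>v (n + n)" using y by (intro eq_vecI) auto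
    thus False using y0 by contradiction
  qed
  show "Re (- b / a) > 0" by (rule scalar_pencil_eigenvalue(1)[of t c k u w]) (fact t c u w bu bw nz)+
  show "cmod (- b / a) > 1" by (rule scalar_pencil_eigenvalue(2)[of t c k u w]) (fact t c u w bu bw nz)+
qed

lemma matrix_pencil_kernel:
  fixes a b :: complex
  assumes n: "n > 1" and c: "c > 0" and K: "K \<in> carrier_mat M M" and rc: "resolvent_condition \<tau> K"
    and V: "V \<in> carrier_mat (n + n) M" and V0: "V \<noteq> 0\<^sub>m (n + n) M" and a: "a \<noteq> 0"
    and eq: "(a \<cdot>\<^sub>m euler_coupling n c + b \<cdot>\<^sub>m corner_mat n) * V
      + (a * complex_of_real \<tau>) \<cdot>\<^sub>m (V * transpose_mat K) = 0\<^sub>m (n + n) M"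
  shows "Re (- b / a) > 0" and "cmod (- b / a) > 1"
proof -
  have G: "a \<cdot>\<^sub>m euler_coupling n c + b \<cdot>\<^sub>m corner_mat n \<in> carrier_mat (n + n) (n + n)"
    using euler_coupling_carrier by simp
  have KT: "transpose_mat K \<in> carrier_mat M M" using K by simp
  obtain \<sigma> y where ev: "eigenvalue (transpose_mat K) \<sigma>"
    and y: "y \<in> carrier_vec (n + n)" "y \<noteq> 0\<^sub>v (n + n)"
    and eqy: "(a \<cdot>\<^sub>m euler_coupling n c + b \<cdot>\<^sub>m corner_mat n) *\<^sub>v y
      + (a * complex_of_real \<tau> * \<sigma>) \<cdot>\<^sub>v y = 0\<^sub>v (n + n)"
    using matrix_equation_reduction[OF G KT V V0 eq] by blast
  have "eigenvalue K \<sigma>"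
    using ev unfolding eigenvalue_root_char_poly[OF KT] eigenvalue_root_char_poly[OF K]
    by (simp add: char_poly_transpose_mat[OF K])
  then obtain t where t: "t > 1" "complex_of_real \<tau> * \<sigma> = complex_of_real (t - 1)"
    using resolvent_eigenvalue[OF rc] by blast
  note * = eqy[unfolded mult.assoc t(2)]
  show "Re (- b / a) > 0" "cmod (- b / a) > 1"
    using shifted_pencil_kernel[OF n t(1) c y a *] by auto
qed

section \<open>The spectrum of the preconditioned matrix\<close>

text \<open>
  With \<open>\<mu> = z / (1 - z)\<close>: \<open>|\<mu>| \<ge> 1\<close> means that \<open>z\<close> is at least as far from \<open>0\<close> as from \<open>1\<close>, and \<open>Re \<mu>\<close> has
  the sign of \<open>Re z - |z|\<^sup>2 = 1/4 - |z - 1/2|\<^sup>2\<close>.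
\<close>

lemma right_half_diskI:
  assumes z: "z \<noteq> 1" and re: "Re (z / (1 - z)) \<ge> 0" and ge: "cmod (z / (1 - z)) \<ge> 1"
  shows "z \<in> right_half_disk"
proof -
  have pos: "cmod (1 - z) > 0" using z by simp
  have "cmod (1 - z) \<le> cmod z" using ge pos by (simp add: norm_divide field_simps)
  hence "(cmod (1 - z))\<^sup>2 \<le> (cmod z)\<^sup>2" by (simp add: power_mono)
  hence h: "Re z \<ge> 1 / 2" unfolding cmod_power2 by (simp add: cmod_power2 power2_eq_square algebra_simps)
  have "Re (z / (1 - z)) = Re (z * cnj (1 - z)) / (cmod (1 - z))\<^sup>2"
    by (simp add: Re_divide cmod_power2)
  hence "Re (z * cnj (1 - z)) \<ge> 0" using re pos by (simp add: zero_le_divide_iff)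
  hence "(cmod (z - 1 / 2))\<^sup>2 \<le> (1 / 2)\<^sup>2"
    unfolding cmod_power2 by (simp add: cmod_power2 power2_eq_square algebra_simps)
  hence "cmod (z - 1 / 2) \<le> 1 / 2" by (rule power2_le_imp_le) simp
  with h show ?thesis by (simp add: right_half_disk_def)
qed

lemma det_nonzero_invertible:
  fixes X :: "'a::field mat"
  assumes X: "X \<in> carrier_mat m m" and inj: "\<And>v. v \<in> carrier_vec m \<Longrightarrow> X *\<^sub>v v = 0\<^sub>v m \<Longrightarrow> v = 0\<^sub>v m"
  shows "invertible_mat X"
proof -
  have "det X \<noteq> 0" using inj det_0_iff_vec_prod_zero_field[OF X] by auto
  from det_non_zero_imp_unit[OF X this, unfolded Units_def, of "()"]
  obtain Y where "Y \<in> carrier_mat m m" "Y * X = 1\<^sub>m m" "X * Y = 1\<^sub>m m"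
    by (auto simp: ring_mat_def)
  thus ?thesis using X by (auto simp: invertible_mat_def inverts_mat_def)
qed

theorem corollary2p3:
  fixes L M :: nat and \<tau> \<gamma> :: real and K :: "complex mat"
  assumes "L > 4" and "\<tau> > 0" and "\<gamma> > 0"
    and "K \<in> carrier_mat M M" and "mat_adjoint K = K"
  shows "(resolvent_condition \<tau> K \<longrightarrow>
      invertible_mat (paradiag_precond L \<tau> \<gamma> K (- 1)) \<and>
      (\<forall>Q z. inverts_mat (paradiag_precond L \<tau> \<gamma> K (- 1)) Q \<and>
             inverts_mat Q (paradiag_precond L \<tau> \<gamma> K (- 1)) \<and>
             eigenvalue (Q * all_at_once L \<tau> \<gamma> K) z \<longrightarrow>
             z \<in> right_half_disk)) \<and>
    (positive_definite K \<longrightarrow> resolvent_condition \<tau> K)"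
proof (intro conjI impI)
  show "resolvent_condition \<tau> K" if "positive_definite K"
    using positive_definite_resolvent_condition[OF assms(2,4) that] .
next
  assume rc: "resolvent_condition \<tau> K"
  let ?P = "paradiag_precond L \<tau> \<gamma> K (- 1)" and ?A = "all_at_once L \<tau> \<gamma> K"
  define n where "n = L - 1"
  have n: "n > 1" using assms(1) by (simp add: n_def)
  define c where "c = \<tau> / sqrt \<gamma>"
  have c: "c > 0" using assms(2,3) by (simp add: c_def)
  note K = assms(4)
  let ?m = "(n + n) * M" and ?U = "unvec (n + n) M" and ?E = "euler_coupling n c" and ?R = "corner_mat n"
  have E: "?E \<in> carrier_mat (n + n) (n + n)" by (rule euler_coupling_carrier)
  have R: "?R \<in> carrier_mat (n + n) (n + n)" by simp
  have AP: "?A \<in> carrier_mat ?m ?m" "?P \<in> carrier_mat ?m ?m"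
    unfolding all_at_once_def paradiag_precond_def n_def[symmetric]
    using K by (intro tracking_mat_carrier mat_adjoint_carrier; simp)+
  have Av: "?U (?A *\<^sub>v v) = ?E * ?U v + complex_of_real \<tau> \<cdot>\<^sub>m (?U v * transpose_mat K)"
    if "v \<in> carrier_vec ?m" for v
    unfolding all_at_once_def n_def[symmetric] c_def
    by (rule unvec_tracking_mat_mult) (use K that in auto)
  have Pv: "?U (?P *\<^sub>v v) = (?E + ?R) * ?U v + complex_of_real \<tau> \<cdot>\<^sub>m (?U v * transpose_mat K)"
    if "v \<in> carrier_vec ?m" for v
    unfolding paradiag_precond_def n_def[symmetric] c_def coupling_alpha_circulant[OF n, symmetric]
    by (rule unvec_tracking_mat_mult) (use K that in \<open>auto intro: mat_adjoint_carrier\<close>)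
  have U0: "?U v \<noteq> 0\<^sub>m (n + n) M" if "v \<in> carrier_vec ?m" "v \<noteq> 0\<^sub>v ?m" for v
    using that unvec_eq_iff[OF that(1) zero_carrier_vec] by (simp add: unvec_zero)
  have pencil: "(x \<cdot>\<^sub>m ?E + y \<cdot>\<^sub>m ?R) * V = x \<cdot>\<^sub>m (?E * V) + y \<cdot>\<^sub>m (?R * V)"
    if "V \<in> carrier_mat (n + n) M" for x y V
    using that E R by (simp add: add_mult_distrib_mat[of _ "n + n" "n + n"]
        mult_smult_assoc_mat[of _ "n + n" "n + n"])
  show "invertible_mat ?P"
  proof (rule det_nonzero_invertible[OF AP(2)], rule ccontr)
    fix v assume v: "v \<in> carrier_vec ?m" and Pv0: "?P *\<^sub>v v = 0\<^sub>v ?m" and v0: "v \<noteq> 0\<^sub>v ?m"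
    \<comment> \<open>The kernel of the preconditioner corresponds to \<open>\<mu> = -1\<close>, whose real part is negative.\<close>
    have "?E + ?R = 1 \<cdot>\<^sub>m ?E + 1 \<cdot>\<^sub>m ?R"
      using carrier_matD[OF E] carrier_matD[OF R] by (intro eq_matI) simp_all
    hence "(1 \<cdot>\<^sub>m ?E + 1 \<cdot>\<^sub>m ?R) * ?U v + (1 * complex_of_real \<tau>) \<cdot>\<^sub>m (?U v * transpose_mat K)
        = 0\<^sub>m (n + n) M"
      using Pv[OF v] unfolding Pv0 unvec_zero by simp
    from matrix_pencil_kernel(1)[OF n c K rc unvec_carrier U0[OF v v0] _ this]
    show False by simp
  qed
  show "\<forall>Q z. inverts_mat ?P Q \<and> inverts_mat Q ?P \<and> eigenvalue (Q * ?A) z \<longrightarrow> z \<in> right_half_disk"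
  proof (intro allI impI, elim conjE)
    fix Q z assume PQ: "inverts_mat ?P Q" and QP: "inverts_mat Q ?P" and ev: "eigenvalue (Q * ?A) z"
    have PQ1: "?P * Q = 1\<^sub>m ?m" using PQ AP by (simp add: inverts_mat_def)
    have "dim_row Q = ?m"
      using arg_cong[OF QP[unfolded inverts_mat_def], of dim_col] AP by simp
    moreover have "dim_col Q = ?m" using arg_cong[OF PQ1, of dim_col] by simp
    ultimately have Q: "Q \<in> carrier_mat ?m ?m" by auto
    from ev obtain v where v: "v \<in> carrier_vec ?m" and v0: "v \<noteq> 0\<^sub>v ?m"
      and QAv: "(Q * ?A) *\<^sub>v v = z \<cdot>\<^sub>v v"
      using Q by (auto simp: eigenvalue_def eigenvector_def)
    have "?A *\<^sub>v v = (?P * Q) *\<^sub>v (?A *\<^sub>v v)" unfolding PQ1 using AP v by simp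
    also have "\<dots> = ?P *\<^sub>v ((Q * ?A) *\<^sub>v v)"
      using AP Q v by (simp add: assoc_mult_mat_vec[of _ ?m ?m _ ?m])
    also have "\<dots> = z \<cdot>\<^sub>v (?P *\<^sub>v v)"
      unfolding QAv using AP v by (simp add: mult_mat_vec[of _ ?m ?m])
    finally have "?U (?A *\<^sub>v v) = z \<cdot>\<^sub>m ?U (?P *\<^sub>v v)"
      using AP v by (simp add: unvec_smult)
    note eq = this[unfolded Av[OF v] Pv[OF v]]
    show "z \<in> right_half_disk"
    proof (cases "z = 1")
      case True
      thus ?thesis by (simp add: right_half_disk_def)
    next
      case False
      define X Y W where "X = ?E * ?U v" and "Y = ?R * ?U v" and "W = ?U v * transpose_mat K"
      have XYW: "X \<in> carrier_mat (n + n) M" "Y \<in> carrier_mat (n + n) M" "W \<in> carrier_mat (n + n) M"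
        unfolding X_def Y_def W_def using E R K
        by (intro mult_carrier_mat[OF _ unvec_carrier] mult_carrier_mat[OF unvec_carrier]; simp)+
      have "(?E + ?R) * ?U v = X + Y"
        unfolding X_def Y_def by (rule add_mult_distrib_mat[OF E R unvec_carrier])
      hence eq': "X + complex_of_real \<tau> \<cdot>\<^sub>m W = z \<cdot>\<^sub>m (X + Y + complex_of_real \<tau> \<cdot>\<^sub>m W)"
        using eq by (simp add: X_def W_def)
      have "(1 - z) \<cdot>\<^sub>m X + (- z) \<cdot>\<^sub>m Y + ((1 - z) * complex_of_real \<tau>) \<cdot>\<^sub>m W = 0\<^sub>m (n + n) M"
      proof (rule eq_matI)
        fix i j assume "i < dim_row (0\<^sub>m (n + n) M :: complex mat)"
          "j < dim_col (0\<^sub>m (n + n) M :: complex mat)"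
        thus "((1 - z) \<cdot>\<^sub>m X + (- z) \<cdot>\<^sub>m Y + ((1 - z) * complex_of_real \<tau>) \<cdot>\<^sub>m W) $$ (i, j)
            = 0\<^sub>m (n + n) M $$ (i, j)"
          using arg_cong[OF eq', of "\<lambda>Z. Z $$ (i, j)"] XYW by (simp add: algebra_simps)
      qed (use XYW in auto)
      hence "((1 - z) \<cdot>\<^sub>m ?E + (- z) \<cdot>\<^sub>m ?R) * ?U v
          + ((1 - z) * complex_of_real \<tau>) \<cdot>\<^sub>m (?U v * transpose_mat K) = 0\<^sub>m (n + n) M"
        unfolding pencil[OF unvec_carrier] X_def Y_def W_def .
      from matrix_pencil_kernel[OF n c K rc unvec_carrier U0[OF v v0] _ this]
      have "Re (z / (1 - z)) > 0" "cmod (z / (1 - z)) > 1" using False by auto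
      thus ?thesis using False by (intro right_half_diskI) auto
    qed
  qed
qed

end
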